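(* Let $\tau>0$ and $A\in\mathbb{R}^{m\times n}$. Suppose only player 2 follows the entropy-regularized OMWU method, while the policies $\bar\mu^{(0)},\bar\mu^{(1)},\dots\in\Delta(\mathcal{A})$ of player 1 are arbitrary. That is, player 2 starts from the uniform policy $\nu^{(0)}(b)=\bar\nu^{(0)}(b)=1/|\mathcal{B}|$ and, for $t\ge0$, updates $$\bar\nu^{(t+1)}(b)\propto\nu^{(t)}(b)^{1-\eta_t\tau}\exp(-\eta_t[A^\top\bar\mu^{(t)}]_b),\qquad\nu^{(t+1)}(b)\propto\nu^{(t)}(b)^{1-\eta_t\tau}\exp(-\eta_t[A^\top\bar\mu^{(t+1)}]_b),$$ with $\eta_t=\frac{1}{(t+1)\tau}$. Then for every integer $T\ge1$ the regret of player 2 in the unregularized matrix game satisfies $$\mathsf{Regret}_0(T)\le\tau^{-1}(\log T+1)\left(\tau\log|\mathcal{B}|+5\|A\|_\infty\right)^2+4\|A\|_\infty+2\tau T\log|\mathcal{B}|.$$ Consequently, choosing $\tau$ of the order $(\log T/T)^{1/2}$ (for $T\ge2$) gives $\mathsf{Regret}_0(T)=O((T\log T)^{1/2})$, where the constant hidden in $O(\cdot)$ may depend on $\|A\|_\infty$ and $|\mathcal{B}|$ but not on $T$ or on the sequence $\{\bar\mu^{(t)}\}$.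
   Context: $\mathcal{A}=\{1,\dots,m\}$, $\mathcal{B}=\{1,\dots,n\}$; $\Delta(\cdot)$ denotes the probability simplex; $\|A\|_\infty=\max_{i,j}|A_{i,j}|$. The symbol $\propto$ means normalization to a probability vector. With $f_0^{(t)}(\nu)=\bar\mu^{(t)\top}A\nu$, the unregularized regret is $$\mathsf{Regret}_0(T)=\sum_{t=0}^Tf_0^{(t)}(\bar\nu^{(t)})-\min_{\nu\in\Delta(\mathcal{B})}\sum_{t=0}^Tf_0^{(t)}(\nu).$$ *)

theory Defs
  imports Complex_Main "Jordan_Normal_Form.Matrix"
begin

(* Matrices and vectors with carriers, not with index types: the constant in the O-bound has
   to be uniform in the number m of actions of player 1, which must hence be quantified inside
   the statement. Actions are numbered from 0. *)

definition simplex :: "nat \<Rightarrow> real vec set" where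
  "simplex k = {v \<in> carrier_vec k. (\<forall>i<k. 0 \<le> v $ i) \<and> (\<Sum>i<k. v $ i) = 1}"

definition max_norm :: "real mat \<Rightarrow> real" where
  "max_norm A = Max {\<bar>A $$ (i, j)\<bar> | i j. i < dim_row A \<and> j < dim_col A}"

definition uniform_policy :: "nat \<Rightarrow> real vec" where
  "uniform_policy k = vec k (\<lambda>_. 1 / real k)"

definition normalized :: "nat \<Rightarrow> (nat \<Rightarrow> real) \<Rightarrow> real vec" where
  "normalized k w = vec k (\<lambda>b. w b / (\<Sum>j<k. w j))"

definition omwu_update :: "real mat \<Rightarrow> real \<Rightarrow> real \<Rightarrow> real vec \<Rightarrow> real vec \<Rightarrow> real vec" where
  "omwu_update A \<tau> \<eta> \<nu> \<mu> =
     normalized (dim_col A)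
       (\<lambda>b. (\<nu> $ b) powr (1 - \<eta> * \<tau>) * exp (- \<eta> * (transpose_mat A *\<^sub>v \<mu>) $ b))"

(* The argument mu is the sequence of policies played by player 1 (the barred sequence).
   omwu_main is the unbarred sequence of player 2, omwu_pred the barred one. *)

fun omwu_main :: "real mat \<Rightarrow> real \<Rightarrow> (nat \<Rightarrow> real) \<Rightarrow> (nat \<Rightarrow> real vec) \<Rightarrow> nat \<Rightarrow> real vec" where
  "omwu_main A \<tau> \<eta> \<mu> 0 = uniform_policy (dim_col A)"
| "omwu_main A \<tau> \<eta> \<mu> (Suc t) =
     omwu_update A \<tau> (\<eta> t) (omwu_main A \<tau> \<eta> \<mu> t) (\<mu> (Suc t))"

fun omwu_pred :: "real mat \<Rightarrow> real \<Rightarrow> (nat \<Rightarrow> real) \<Rightarrow> (nat \<Rightarrow> real vec) \<Rightarrow> nat \<Rightarrow> real vec" where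
  "omwu_pred A \<tau> \<eta> \<mu> 0 = uniform_policy (dim_col A)"
| "omwu_pred A \<tau> \<eta> \<mu> (Suc t) =
     omwu_update A \<tau> (\<eta> t) (omwu_main A \<tau> \<eta> \<mu> t) (\<mu> t)"

definition step_size :: "real \<Rightarrow> nat \<Rightarrow> real" where
  "step_size \<tau> t = 1 / ((real t + 1) * \<tau>)"

definition loss :: "real mat \<Rightarrow> real vec \<Rightarrow> real vec \<Rightarrow> real" where
  "loss A \<mu> \<nu> = \<mu> \<bullet> (A *\<^sub>v \<nu>)"

(* The infimum is a minimum: a linear function on a nonempty compact simplex. *)

definition regret :: "real mat \<Rightarrow> (nat \<Rightarrow> real vec) \<Rightarrow> (nat \<Rightarrow> real vec) \<Rightarrow> nat \<Rightarrow> real" where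
  "regret A \<mu> \<nu> T =
     (\<Sum>t=0..T. loss A (\<mu> t) (\<nu> t)) -
     (INF \<nu>'\<in>simplex (dim_col A). \<Sum>t=0..T. loss A (\<mu> t) \<nu>')"

definition omwu_regret :: "real mat \<Rightarrow> real \<Rightarrow> (nat \<Rightarrow> real vec) \<Rightarrow> nat \<Rightarrow> real" where
  "omwu_regret A \<tau> \<mu> T = regret A \<mu> (omwu_pred A \<tau> (step_size \<tau>) \<mu>) T"

end

theory Submission
  imports Defs
begin

text \<open>Since \<open>1 - \<eta>\<^sub>t \<tau> = t / (t + 1)\<close>, the unbarred iterate is \<open>\<nu>\<^sub>t \<propto> exp (- S\<^sub>t / (t \<tau>))\<close>, where \<open>S\<^sub>t\<close>
  is the sum of the loss vectors \<open>c\<^sub>s = A\<^sup>T \<mu>\<^sub>s\<close> for \<open>1 \<le> s \<le> t\<close>: it minimises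
  \<open>\<langle>S\<^sub>t, \<nu>\<rangle> - t \<tau> H(\<nu>)\<close>, with minimum \<open>\<Phi>\<^sub>t = - t \<tau> ln (\<Sum>b. exp (- S\<^sub>t(b) / (t \<tau>)))\<close>. Gibbs' inequality
  gives \<open>\<langle>c\<^sub>t\<^sub>+\<^sub>1, \<nu>\<^sub>t\<^sub>+\<^sub>1\<rangle> \<le> \<Phi>\<^sub>t\<^sub>+\<^sub>1 - \<Phi>\<^sub>t + \<tau> ln n\<close> ("be the leader"), which telescopes, and
  \<open>\<Phi>\<^sub>T \<le> S\<^sub>T(b)\<close> for every pure action \<open>b\<close>. The logits of the barred iterate differ from those of
  \<open>\<nu>\<^sub>t\<close> by at most \<open>2 \<parallel>A\<parallel>\<^sub>\<infinity> / (t \<tau>)\<close>, so replacing \<open>\<nu>\<^sub>t\<close> by it costs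
  \<open>O(\<parallel>A\<parallel>\<^sub>\<infinity>\<^sup>2 / (t \<tau>))\<close> in step \<open>t\<close>, and these costs sum to a harmonic sum.\<close>

section \<open>Softmax: Gibbs' inequality and stability under changes of the logits\<close>

definition softmax :: "'a set \<Rightarrow> ('a \<Rightarrow> real) \<Rightarrow> 'a \<Rightarrow> real" where
  "softmax I x b = exp (x b) / (\<Sum>j\<in>I. exp (x j))"

lemma sum_exp_pos:
  fixes x :: "'a \<Rightarrow> real"
  assumes "finite I" "I \<noteq> {}"
  shows "0 < (\<Sum>j\<in>I. exp (x j))"
  using assms by (intro sum_pos) auto

lemma softmax_pos:
  assumes "finite I" "I \<noteq> {}"
  shows "0 < softmax I x b"
  unfolding softmax_def using sum_exp_pos[OF assms] by simp

lemma sum_softmax: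
  assumes "finite I" "I \<noteq> {}"
  shows "(\<Sum>b\<in>I. softmax I x b) = 1"
  unfolding softmax_def using sum_exp_pos[OF assms, of x] by (simp add: sum_divide_distrib[symmetric])

lemma ln_softmax:
  assumes "finite I" "I \<noteq> {}"
  shows "ln (softmax I x b) = x b - ln (\<Sum>j\<in>I. exp (x j))"
  unfolding softmax_def using sum_exp_pos[OF assms, of x] by (simp add: ln_div)

text \<open>Nonnegativity of the relative entropy of \<open>p\<close> from \<open>w / Z\<close>,
  with \<open>Z\<close> the total weight. Averaging ln x \<le> x - 1 at x = w_i / (p_i Z) with
  weights p_i, the right-hand side vanishes because \<open>p\<close> and \<open>w / Z\<close> both
  have mass 1.\<close>

lemma gibbs_inequality:
  fixes p w :: "'a \<Rightarrow> real"
  assumes fin: "finite I" and p: "\<And>i. i \<in> I \<Longrightarrow> 0 < p i" and p1: "sum p I = 1"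
    and w: "\<And>i. i \<in> I \<Longrightarrow> 0 < w i"
  shows "(\<Sum>i\<in>I. p i * (ln (w i) - ln (p i))) \<le> ln (sum w I)"
proof -
  define Z where "Z = sum w I"
  have "I \<noteq> {}" using p1 by auto
  then have Z: "Z > 0" unfolding Z_def using fin w by (intro sum_pos) auto
  have "p i * (ln (w i) - ln (p i)) \<le> p i * (ln Z - 1) + w i / Z" if "i \<in> I" for i
  proof -
    have "ln (w i / (p i * Z)) \<le> w i / (p i * Z) - 1"
      using p[OF that] w[OF that] Z by (intro ln_le_minus_one) simp
    then have "ln (w i) - ln (p i) \<le> ln Z - 1 + w i / (p i * Z)"
      using p[OF that] w[OF that] Z by (simp add: ln_div ln_mult)
    then have "p i * (ln (w i) - ln (p i)) \<le> p i * (ln Z - 1 + w i / (p i * Z))"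
      using p[OF that] by (intro mult_left_mono) auto
    also have "\<dots> = p i * (ln Z - 1) + w i / Z"
      using p[OF that] Z by (simp add: distrib_left)
    finally show ?thesis .
  qed
  then have "(\<Sum>i\<in>I. p i * (ln (w i) - ln (p i))) \<le> (\<Sum>i\<in>I. p i * (ln Z - 1) + w i / Z)"
    by (intro sum_mono)
  also have "\<dots> = sum p I * (ln Z - 1) + sum w I / Z"
    by (simp add: sum.distrib sum_distrib_right sum_divide_distrib)
  also have "\<dots> = ln Z" using p1 Z by (simp add: Z_def)
  finally show ?thesis by (simp add: Z_def)
qed

text \<open>A change of the logits by at most \<open>d\<close> moves the numerator and the partition
  function each by a factor of at most exp d. Hence \<open>y\<close> keeps at least the fraction exp
  (-2d) \<ge> 1 - 2d of the probability under \<open>x\<close>.\<close>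

lemma softmax_diff_le:
  assumes fin: "finite I" "I \<noteq> {}" and b: "b \<in> I"
    and d: "\<And>j. j \<in> I \<Longrightarrow> \<bar>x j - y j\<bar> \<le> d"
  shows "softmax I x b - softmax I y b \<le> 2 * d * softmax I x b"
proof -
  have "(\<Sum>j\<in>I. exp (y j)) \<le> (\<Sum>j\<in>I. exp d * exp (x j))"
  proof (intro sum_mono)
    fix j assume "j \<in> I"
    then show "exp (y j) \<le> exp d * exp (x j)"
      using d[of j] by (simp add: exp_add[symmetric] abs_le_iff)
  qed
  then have "ln (\<Sum>j\<in>I. exp (y j)) \<le> ln (exp d * (\<Sum>j\<in>I. exp (x j)))"
    using sum_exp_pos[OF fin, of y] sum_exp_pos[OF fin, of x]
    by (subst ln_le_cancel_iff) (auto simp: sum_distrib_left)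
  also have "\<dots> = d + ln (\<Sum>j\<in>I. exp (x j))"
    using sum_exp_pos[OF fin, of x] by (simp add: ln_mult)
  finally have "ln (softmax I x b) - 2 * d \<le> ln (softmax I y b)"
    unfolding ln_softmax[OF fin] using d[OF b] by (auto simp: abs_le_iff)
  then have "exp (ln (softmax I x b) - 2 * d) \<le> exp (ln (softmax I y b))"
    by simp
  then have "softmax I x b * exp (- (2 * d)) \<le> softmax I y b"
    using softmax_pos[OF fin, of x b] softmax_pos[OF fin, of y b]
    by (simp add: exp_diff exp_minus divide_inverse)
  moreover have "softmax I x b * (1 - 2 * d) \<le> softmax I x b * exp (- (2 * d))"
    using softmax_pos[OF fin, of x b] exp_ge_add_one_self[of "- (2 * d)"]
    by (intro mult_left_mono) auto
  ultimately show ?thesis by (simp add: algebra_simps)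
qed

text \<open>The one-sided estimate, used in both directions, bounds each absolute difference by
  \<open>2 * d\<close> times the sum of the two probabilities; both distributions have mass 1, hence
  the factor 4.\<close>

lemma softmax_l1_diff_le:
  assumes fin: "finite I" "I \<noteq> {}"
    and d: "\<And>j. j \<in> I \<Longrightarrow> \<bar>x j - y j\<bar> \<le> d"
  shows "(\<Sum>b\<in>I. \<bar>softmax I x b - softmax I y b\<bar>) \<le> 4 * d"
proof -
  have d0: "d \<ge> 0" using fin d by force
  have "\<bar>softmax I x b - softmax I y b\<bar> \<le> 2 * d * (softmax I x b + softmax I y b)" if "b \<in> I" for b
  proof -
    have "softmax I x b - softmax I y b \<le> 2 * d * softmax I x b"
      using softmax_diff_le[OF fin that d] .
    moreover have "softmax I y b - softmax I x b \<le> 2 * d * softmax I y b"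
      using d by (intro softmax_diff_le[OF fin that]) (simp add: abs_minus_commute)
    moreover have "0 \<le> 2 * d * softmax I x b" "0 \<le> 2 * d * softmax I y b"
      using d0 less_imp_le[OF softmax_pos[OF fin]] by (auto intro!: mult_nonneg_nonneg)
    ultimately show ?thesis by (simp add: distrib_left abs_le_iff)
  qed
  then have "(\<Sum>b\<in>I. \<bar>softmax I x b - softmax I y b\<bar>)
      \<le> (\<Sum>b\<in>I. 2 * d * (softmax I x b + softmax I y b))"
    by (intro sum_mono)
  also have "\<dots> = 2 * d * ((\<Sum>b\<in>I. softmax I x b) + (\<Sum>b\<in>I. softmax I y b))"
    by (simp only: sum_distrib_left[symmetric] sum.distrib)
  also have "\<dots> = 4 * d" by (simp add: sum_softmax[OF fin])
  finally show ?thesis .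
qed

lemma sum_weighted_le:
  fixes c q :: "'a \<Rightarrow> real"
  assumes "\<And>b. b \<in> I \<Longrightarrow> \<bar>c b\<bar> \<le> M"
  shows "(\<Sum>b\<in>I. c b * q b) \<le> M * (\<Sum>b\<in>I. \<bar>q b\<bar>)"
proof -
  have "c b * q b \<le> M * \<bar>q b\<bar>" if "b \<in> I" for b
    using mult_right_mono[OF assms[OF that], of "\<bar>q b\<bar>"] abs_ge_self[of "c b * q b"]
    by (simp add: abs_mult)
  then show ?thesis unfolding sum_distrib_left by (intro sum_mono)
qed

section \<open>The leader, its free energy and the be-the-leader bound\<close>

text \<open>The sum starts at 1 because the unbarred update into round \<open>Suc t\<close> uses the
  policy of round \<open>Suc t\<close>: the loss of round 0 enters no unbarred iterate.\<close>

definition cum_loss :: "(nat \<Rightarrow> 'a \<Rightarrow> real) \<Rightarrow> nat \<Rightarrow> 'a \<Rightarrow> real" where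
  "cum_loss c t b = (\<Sum>s=1..t. c s b)"

lemma cum_loss_0 [simp]: "cum_loss c 0 b = 0"
  and cum_loss_Suc [simp]: "cum_loss c (Suc t) b = cum_loss c t b + c (Suc t) b"
  by (simp_all add: cum_loss_def)

text \<open>At \<open>t = 0\<close> division by zero makes this the uniform distribution.\<close>

definition leader :: "'a set \<Rightarrow> real \<Rightarrow> (nat \<Rightarrow> 'a \<Rightarrow> real) \<Rightarrow> nat \<Rightarrow> 'a \<Rightarrow> real" where
  "leader I \<tau> c t = softmax I (\<lambda>b. - cum_loss c t b / (real t * \<tau>))"

text \<open>The prefactor makes it vanish at \<open>t = 0\<close>, which is where the telescoping
  starts.\<close>

definition free_energy :: "'a set \<Rightarrow> real \<Rightarrow> (nat \<Rightarrow> 'a \<Rightarrow> real) \<Rightarrow> nat \<Rightarrow> real" where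
  "free_energy I \<tau> c t = - (real t * \<tau>) * ln (\<Sum>b\<in>I. exp (- cum_loss c t b / (real t * \<tau>)))"

text \<open>The leader \<open>p\<close> of round t+1 attains the minimum \<Phi>_(t+1) and is a mere
  candidate for the minimum \<Phi>_t. Subtracting leaves the loss of round t+1 minus \<tau> times
  the entropy of \<open>p\<close>, and that entropy is at most \<open>ln (card I)\<close>.\<close>

lemma leader_step:
  assumes fin: "finite I" "I \<noteq> {}" and \<tau>: "\<tau> > 0"
  shows "(\<Sum>b\<in>I. c (Suc t) b * leader I \<tau> c (Suc t) b)
         \<le> free_energy I \<tau> c (Suc t) - free_energy I \<tau> c t + \<tau> * ln (card I)"
proof -
  define p where "p = leader I \<tau> c (Suc t)"
  define h where "h = (\<Sum>b\<in>I. p b * ln (p b))"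
  have p0: "p b > 0" for b using softmax_pos[OF fin] by (simp add: p_def leader_def)
  have p1: "sum p I = 1" using sum_softmax[OF fin] by (simp add: p_def leader_def)
  \<comment> \<open>\<open>p\<close> as a candidate in round t, by Gibbs' inequality with the
    exponential weights; \<open>h\<close> is the negative entropy of \<open>p\<close>. For
    \<open>t = 0\<close> both sides are 0.\<close>
  have prev: "free_energy I \<tau> c t \<le> (\<Sum>b\<in>I. cum_loss c t b * p b) + real t * \<tau> * h"
  proof (cases "t = 0")
    case True
    then show ?thesis by (simp add: free_energy_def)
  next
    case False
    then have l: "real t * \<tau> > 0" using \<tau> by simp
    have "(\<Sum>b\<in>I. p b * (ln (exp (- cum_loss c t b / (real t * \<tau>))) - ln (p b)))
          \<le> ln (\<Sum>b\<in>I. exp (- cum_loss c t b / (real t * \<tau>)))"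
      by (rule gibbs_inequality[OF fin(1) p0 p1]) simp
    then have "- (real t * \<tau>) * ln (\<Sum>b\<in>I. exp (- cum_loss c t b / (real t * \<tau>)))
        \<le> - (real t * \<tau>) * (\<Sum>b\<in>I. p b * (- cum_loss c t b / (real t * \<tau>) - ln (p b)))"
      using l by (intro mult_left_mono_neg) auto
    also have "\<dots> = (\<Sum>b\<in>I. cum_loss c t b * p b + real t * \<tau> * (p b * ln (p b)))"
      unfolding sum_distrib_left using l by (intro sum.cong) (auto simp: field_simps)
    finally show ?thesis
      by (simp add: free_energy_def h_def sum.distrib sum_distrib_left)
  qed
  \<comment> \<open>Equality for the minimiser: \<open>ln (p b)\<close> is affine in the cumulative
    loss, so loss plus scaled logarithm is the same for every action.\<close>
  have "(\<Sum>b\<in>I. cum_loss c (Suc t) b * p b) + real (Suc t) * \<tau> * h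
      = (\<Sum>b\<in>I. p b * free_energy I \<tau> c (Suc t))"
  proof -
    have l: "real (Suc t) * \<tau> > 0" using \<tau> by simp
    have "cum_loss c (Suc t) b * p b + real (Suc t) * \<tau> * (p b * ln (p b))
          = p b * free_energy I \<tau> c (Suc t)" for b
    proof -
      have "ln (p b) = - cum_loss c (Suc t) b / (real (Suc t) * \<tau>)
          - ln (\<Sum>b\<in>I. exp (- cum_loss c (Suc t) b / (real (Suc t) * \<tau>)))"
        unfolding p_def leader_def ln_softmax[OF fin] ..
      then have "real (Suc t) * \<tau> * ln (p b) = - cum_loss c (Suc t) b + free_energy I \<tau> c (Suc t)"
        unfolding free_energy_def
        using \<tau> by (simp del: cum_loss_Suc of_nat_Suc add: right_diff_distrib)
      then have "p b * (real (Suc t) * \<tau> * ln (p b))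
          = p b * (- cum_loss c (Suc t) b + free_energy I \<tau> c (Suc t))" by simp
      then show ?thesis by (simp only: algebra_simps)
    qed
    then show ?thesis by (simp only: h_def sum_distrib_left sum.distrib[symmetric])
  qed
  then have cur: "(\<Sum>b\<in>I. cum_loss c t b * p b) + (\<Sum>b\<in>I. c (Suc t) b * p b)
      + (real t * \<tau> * h + \<tau> * h) = free_energy I \<tau> c (Suc t)"
    using p1 by (simp add: sum_distrib_right[symmetric] sum.distrib algebra_simps)
  \<comment> \<open>Unit weights turn Gibbs' inequality into the maximum entropy bound.\<close>
  have "(\<Sum>b\<in>I. p b * (ln 1 - ln (p b))) \<le> ln (\<Sum>b\<in>I. 1)"
    by (rule gibbs_inequality[OF fin(1) p0 p1]) simp
  then have "- h \<le> ln (card I)" by (simp add: h_def sum_negf)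
  then have "\<tau> * (- h) \<le> \<tau> * ln (card I)" using \<tau> by (intro mult_left_mono) auto
  with prev cur show ?thesis unfolding p_def by simp
qed

text \<open>A pure action has zero entropy, so its regularised loss is its plain loss. Concretely,
  log-sum-exp dominates each of its exponents.\<close>

lemma free_energy_le_cum_loss:
  assumes fin: "finite I" and b: "b \<in> I" and \<tau>: "\<tau> > 0"
  shows "free_energy I \<tau> c t \<le> cum_loss c t b"
proof (cases "t = 0")
  case True
  then show ?thesis by (simp add: free_energy_def)
next
  case False
  then have l: "real t * \<tau> > 0" using \<tau> by simp
  have "exp (- cum_loss c t b / (real t * \<tau>)) \<le> (\<Sum>b\<in>I. exp (- cum_loss c t b / (real t * \<tau>)))"
    using fin b by (intro member_le_sum) auto
  then have "- cum_loss c t b / (real t * \<tau>) \<le> ln (\<Sum>b\<in>I. exp (- cum_loss c t b / (real t * \<tau>)))"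
    using sum_exp_pos[OF fin, of "\<lambda>b. - cum_loss c t b / (real t * \<tau>)"] b
    by (subst ln_ge_iff) auto
  then have "- (real t * \<tau>) * ln (\<Sum>b\<in>I. exp (- cum_loss c t b / (real t * \<tau>)))
      \<le> - (real t * \<tau>) * (- cum_loss c t b / (real t * \<tau>))"
    using l by (intro mult_left_mono_neg) auto
  then show ?thesis using False \<tau> by (simp add: free_energy_def)
qed

lemma be_the_leader:
  assumes "finite I" "b \<in> I" "\<tau> > 0"
  shows "(\<Sum>t=1..T. \<Sum>j\<in>I. c t j * leader I \<tau> c t j) \<le> cum_loss c T b + real T * \<tau> * ln (card I)"
proof -
  have "(\<Sum>t=1..T. \<Sum>j\<in>I. c t j * leader I \<tau> c t j) \<le> free_energy I \<tau> c T + real T * \<tau> * ln (card I)"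
  proof (induction T)
    case 0
    then show ?case by (simp add: free_energy_def)
  next
    case (Suc T)
    have "I \<noteq> {}" using assms by auto
    from leader_step[of I \<tau> c T, OF assms(1) this assms(3)] Suc show ?case
      by (simp add: algebra_simps)
  qed
  then show ?thesis using free_energy_le_cum_loss[OF assms, of c T] by linarith
qed

section \<open>Regret of the optimistic iterates against a pure action\<close>

lemma harmonic_sum_le:
  assumes "T \<ge> 1"
  shows "(\<Sum>t=1..T. inverse (real t)) \<le> ln (real T) + 1"
  using assms
proof (induction T rule: dec_induct)
  case base
  show ?case by simp
next
  case (step T)
  have "ln (real T / real (Suc T)) \<le> real T / real (Suc T) - 1"
    using step.hyps by (intro ln_le_minus_one) simp
  also have "\<dots> = - inverse (real (Suc T))" by (simp add: field_simps)
  finally have "inverse (real (Suc T)) \<le> ln (real (Suc T)) - ln (real T)"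
    using step.hyps by (simp add: ln_div)
  with step.IH show ?case by simp
qed

text \<open>For t \<ge> 1 the played \<open>\<pi> t\<close> is compared with the leader, which
  already knows \<open>c t\<close>; the errors decay like 1/t and sum to a harmonic sum. Round 0 is
  estimated crudely and separately.\<close>

lemma optimistic_regret_le:
  fixes c \<pi> :: "nat \<Rightarrow> 'a \<Rightarrow> real"
  assumes fin: "finite I" and b: "b \<in> I" and \<tau>: "\<tau> > 0"
    and c: "\<And>t j. j \<in> I \<Longrightarrow> \<bar>c t j\<bar> \<le> M"
    and \<pi>0: "(\<Sum>j\<in>I. \<bar>\<pi> 0 j\<bar>) = 1"
    and \<pi>: "\<And>t. \<pi> (Suc t) = softmax I (\<lambda>j. - (cum_loss c t j + c t j) / (real (Suc t) * \<tau>))"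
    and T: "T \<ge> 1"
  shows "(\<Sum>t=0..T. \<Sum>j\<in>I. c t j * \<pi> t j)
         \<le> (\<Sum>t=0..T. c t b) + 8 * M\<^sup>2 / \<tau> * (ln (real T) + 1) + 2 * M + \<tau> * real T * ln (card I)"
proof -
  have ne: "I \<noteq> {}" using b by auto
  have M: "M \<ge> 0" using c[OF b, of 0] by linarith
  have step: "(\<Sum>j\<in>I. c t j * \<pi> t j)
      \<le> (\<Sum>j\<in>I. c t j * leader I \<tau> c t j) + 8 * M\<^sup>2 / \<tau> * inverse (real t)" if t: "t \<in> {1..T}" for t
  proof -
    obtain s where s: "t = Suc s" using t by (cases t) auto
    \<comment> \<open>Both logits have denominator \<open>real t * \<tau>\<close>; the numerators
      differ only by the prediction \<open>c s\<close> standing in for the true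
      \<open>c t\<close>.\<close>
    have "\<bar>- (cum_loss c s j + c s j) / (real t * \<tau>) - - cum_loss c t j / (real t * \<tau>)\<bar>
        \<le> 2 * M / (real t * \<tau>)" if "j \<in> I" for j
    proof -
      have "- (cum_loss c s j + c s j) / (real t * \<tau>) - - cum_loss c t j / (real t * \<tau>)
          = (c t j - c s j) / (real t * \<tau>)"
        by (simp add: s diff_divide_distrib add_divide_distrib)
      moreover have "\<bar>c t j - c s j\<bar> \<le> 2 * M"
        using c[OF that, of t] c[OF that, of s] by linarith
      ultimately show ?thesis using \<tau> by (simp add: abs_divide divide_right_mono)
    qed
    \<comment> \<open>Softmax stability turns 2M/(t\<tau>) into an l1 distance of 8M/(t\<tau>);
      pairing it with \<open>c t\<close> costs another factor M.\<close>
    then have "(\<Sum>j\<in>I. \<bar>\<pi> t j - leader I \<tau> c t j\<bar>) \<le> 4 * (2 * M / (real t * \<tau>))"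
      unfolding s \<pi> leader_def by (intro softmax_l1_diff_le[OF fin ne]) (simp add: s)
    then have "M * (\<Sum>j\<in>I. \<bar>\<pi> t j - leader I \<tau> c t j\<bar>) \<le> M * (4 * (2 * M / (real t * \<tau>)))"
      using M by (rule mult_left_mono)
    also have "\<dots> = 8 * M\<^sup>2 / \<tau> * inverse (real t)"
      by (simp add: power2_eq_square divide_inverse)
    finally have "(\<Sum>j\<in>I. c t j * (\<pi> t j - leader I \<tau> c t j)) \<le> 8 * M\<^sup>2 / \<tau> * inverse (real t)"
      using sum_weighted_le[of I "c t" M "\<lambda>j. \<pi> t j - leader I \<tau> c t j"] c by fastforce
    then show ?thesis by (simp add: right_diff_distrib sum_subtractf)
  qed
  have "(\<Sum>t=1..T. \<Sum>j\<in>I. c t j * \<pi> t j)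
      \<le> (\<Sum>t=1..T. (\<Sum>j\<in>I. c t j * leader I \<tau> c t j) + 8 * M\<^sup>2 / \<tau> * inverse (real t))"
    using step by (rule sum_mono)
  also have "\<dots> = (\<Sum>t=1..T. \<Sum>j\<in>I. c t j * leader I \<tau> c t j) + 8 * M\<^sup>2 / \<tau> * (\<Sum>t=1..T. inverse (real t))"
    by (simp add: sum.distrib sum_distrib_left)
  also have "\<dots> \<le> (cum_loss c T b + real T * \<tau> * ln (card I)) + 8 * M\<^sup>2 / \<tau> * (ln (real T) + 1)"
    using be_the_leader[OF fin b \<tau>] harmonic_sum_le[OF T] \<tau>
    by (intro add_mono mult_left_mono) auto
  finally have "(\<Sum>t=1..T. \<Sum>j\<in>I. c t j * \<pi> t j)
      \<le> cum_loss c T b + real T * \<tau> * ln (card I) + 8 * M\<^sup>2 / \<tau> * (ln (real T) + 1)" .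
  \<comment> \<open>Round 0 costs at most M, and the comparator saves at most M there: this is the
    summand \<open>2 * M\<close>.\<close>
  moreover have "(\<Sum>j\<in>I. c 0 j * \<pi> 0 j) \<le> M"
    using sum_weighted_le[of I "c 0" M "\<pi> 0"] c \<pi>0 by simp
  moreover have "(\<Sum>t=0..T. \<Sum>j\<in>I. c t j * \<pi> t j)
      = (\<Sum>j\<in>I. c 0 j * \<pi> 0 j) + (\<Sum>t=1..T. \<Sum>j\<in>I. c t j * \<pi> t j)"
    by (simp add: sum.atLeast_Suc_atMost)
  moreover have "(\<Sum>t=0..T. c t b) = c 0 b + cum_loss c T b"
    by (simp add: sum.atLeast_Suc_atMost cum_loss_def)
  moreover have "- M \<le> c 0 b" using c[OF b, of 0] by linarith
  moreover have "real T * \<tau> * ln (card I) = \<tau> * real T * ln (card I)" by simp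
  ultimately show ?thesis by linarith
qed

section \<open>Closed form of the OMWU iterates\<close>

lemma normalized_exp:
  assumes "K > 0" "\<And>b. b < k \<Longrightarrow> w b = K * exp (x b)"
  shows "normalized k w = vec k (softmax {..<k} x)"
proof -
  have "(\<Sum>j<k. w j) = K * (\<Sum>j<k. exp (x j))"
    by (simp add: assms(2) sum_distrib_left)
  then show ?thesis unfolding normalized_def softmax_def using assms by (intro eq_vecI) auto
qed

text \<open>In the logits the multiplicative update is affine, since powers of exponentials scale
  the exponents.\<close>

lemma omwu_update_softmax:
  fixes x :: "nat \<Rightarrow> real"
  assumes n: "dim_col A = n" "n \<ge> 1"
  shows "omwu_update A \<tau> \<eta> (vec n (softmax {..<n} x)) \<mu>
    = vec n (softmax {..<n} (\<lambda>b. (1 - \<eta> * \<tau>) * x b - \<eta> * (transpose_mat A *\<^sub>v \<mu>) $ b))"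
proof -
  define Z where "Z = (\<Sum>j<n. exp (x j))"
  have Z: "Z > 0" unfolding Z_def using n by (intro sum_exp_pos) (auto simp: lessThan_empty_iff)
  show ?thesis unfolding omwu_update_def n
  \<comment> \<open>\<open>K\<close> is the old partition function carried through the power; it is
    common to all actions, so normalisation removes it.\<close>
  proof (rule normalized_exp[where K = "Z powr (- (1 - \<eta> * \<tau>))"])
    show "0 < Z powr (- (1 - \<eta> * \<tau>))" using Z by simp
    fix b assume "b < n"
    have "ln (exp (x b) / Z) = x b - ln Z" using Z by (simp add: ln_div)
    then have "(exp (x b) / Z) powr (1 - \<eta> * \<tau>)
        = Z powr (- (1 - \<eta> * \<tau>)) * exp ((1 - \<eta> * \<tau>) * x b)"
      unfolding powr_def using Z by (simp add: exp_add[symmetric]) (simp add: algebra_simps)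
    then show "(vec n (softmax {..<n} x) $ b) powr (1 - \<eta> * \<tau>)
          * exp (- \<eta> * (transpose_mat A *\<^sub>v \<mu>) $ b)
        = Z powr (- (1 - \<eta> * \<tau>))
          * exp ((1 - \<eta> * \<tau>) * x b - \<eta> * (transpose_mat A *\<^sub>v \<mu>) $ b)"
      using \<open>b < n\<close> by (simp add: softmax_def Z_def[symmetric] exp_diff exp_minus divide_inverse)
  qed
qed

abbreviation payoffs :: "real mat \<Rightarrow> (nat \<Rightarrow> real vec) \<Rightarrow> nat \<Rightarrow> nat \<Rightarrow> real" where
  "payoffs A \<mu> t b \<equiv> (transpose_mat A *\<^sub>v \<mu> t) $ b"

text \<open>With 1 - \<eta>_t \<tau> = t/(t+1), old logits with denominator t\<tau> and the new term
  \<eta>_t u acquire the common denominator (t+1)\<tau>. It serves both sequences: \<open>u\<close>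
  is the loss of round t+1 for the unbarred and of round t for the barred one.\<close>

lemma step_size_logit:
  assumes \<tau>: "\<tau> > 0" and "t = 0 \<Longrightarrow> S = 0"
  shows "(1 - step_size \<tau> t * \<tau>) * (- S / (real t * \<tau>)) - step_size \<tau> t * u
    = - (S + u) / (real (Suc t) * \<tau>)"
proof -
  have "(1 - step_size \<tau> t * \<tau>) * (- S / (real t * \<tau>)) = - S / (real (Suc t) * \<tau>)"
  \<comment> \<open>At \<open>t = 0\<close> the left side is 0, and the right side agrees because
    \<open>S = 0\<close> there.\<close>
  proof (cases "t = 0")
    case False
    have "1 - step_size \<tau> t * \<tau> = real t / real (Suc t)"
      using \<tau> unfolding step_size_def by (simp add: diff_divide_eq_iff)
    then show ?thesis using False by simp
  qed (use assms in simp)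
  then show ?thesis by (simp add: step_size_def diff_divide_distrib add.commute)
qed

lemma omwu_main_eq_leader:
  assumes n: "dim_col A = n" "n \<ge> 1" and \<tau>: "\<tau> > 0"
  shows "omwu_main A \<tau> (step_size \<tau>) \<mu> t = vec n (leader {..<n} \<tau> (payoffs A \<mu>) t)"
proof (induction t)
  case 0
  then show ?case
    using n by (intro eq_vecI) (auto simp: uniform_policy_def leader_def softmax_def)
next
  case (Suc t)
  have "(1 - step_size \<tau> t * \<tau>) * (- cum_loss (payoffs A \<mu>) t b / (real t * \<tau>))
      - step_size \<tau> t * payoffs A \<mu> (Suc t) b
      = - cum_loss (payoffs A \<mu>) (Suc t) b / (real (Suc t) * \<tau>)" for b
    using step_size_logit[OF \<tau>, of t "cum_loss (payoffs A \<mu>) t b"] by simp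
  then show ?case
    by (simp add: Suc leader_def omwu_update_softmax[OF n] del: cum_loss_Suc of_nat_Suc)
qed

text \<open>The barred update starts from the same unbarred iterate but reuses the loss of round t
  as a prediction for round t+1.\<close>

lemma omwu_pred_Suc_eq_softmax:
  assumes n: "dim_col A = n" "n \<ge> 1" and \<tau>: "\<tau> > 0"
  shows "omwu_pred A \<tau> (step_size \<tau>) \<mu> (Suc t) = vec n (softmax {..<n}
    (\<lambda>b. - (cum_loss (payoffs A \<mu>) t b + payoffs A \<mu> t b) / (real (Suc t) * \<tau>)))"
proof -
  have "(1 - step_size \<tau> t * \<tau>) * (- cum_loss (payoffs A \<mu>) t b / (real t * \<tau>))
      - step_size \<tau> t * payoffs A \<mu> t b
      = - (cum_loss (payoffs A \<mu>) t b + payoffs A \<mu> t b) / (real (Suc t) * \<tau>)" for b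
    by (rule step_size_logit[OF \<tau>]) simp
  then show ?thesis
    by (simp add: omwu_main_eq_leader[OF assms] leader_def omwu_update_softmax[OF n] del: of_nat_Suc)
qed

section \<open>Losses and regret of the matrix game\<close>

lemma loss_eq_sum:
  assumes "A \<in> carrier_mat m n" "\<mu> t \<in> carrier_vec m" "\<nu> \<in> carrier_vec n"
  shows "loss A (\<mu> t) \<nu> = (\<Sum>b<n. payoffs A \<mu> t b * \<nu> $ b)"
proof -
  have "loss A (\<mu> t) \<nu> = (transpose_mat A *\<^sub>v \<mu> t) \<bullet> \<nu>"
    unfolding loss_def using transpose_vec_mult_scalar[OF assms(1,3,2)] by simp
  then show ?thesis using assms(3) by (simp add: scalar_prod_def lessThan_atLeast0)
qed

lemma abs_entry_le_max_norm:
  assumes "i < dim_row A" "j < dim_col A"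
  shows "\<bar>A $$ (i, j)\<bar> \<le> max_norm A"
proof -
  have "{\<bar>A $$ (i, j)\<bar> | i j. i < dim_row A \<and> j < dim_col A}
      = (\<lambda>(i, j). \<bar>A $$ (i, j)\<bar>) ` ({..<dim_row A} \<times> {..<dim_col A})"
    by auto
  then have "finite {\<bar>A $$ (i, j)\<bar> | i j. i < dim_row A \<and> j < dim_col A}" by simp
  then show ?thesis unfolding max_norm_def using assms by (intro Max_ge) auto
qed

text \<open>Each payoff is a convex combination of the entries of one column.\<close>

lemma abs_payoffs_le_max_norm:
  assumes A: "A \<in> carrier_mat m n" and \<mu>: "\<mu> t \<in> simplex m" and b: "b < n"
  shows "\<bar>payoffs A \<mu> t b\<bar> \<le> max_norm A"
proof -
  have mu: "dim_vec (\<mu> t) = m" "\<And>i. i < m \<Longrightarrow> 0 \<le> \<mu> t $ i" "(\<Sum>i<m. \<mu> t $ i) = 1"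
    using \<mu> by (auto simp: simplex_def)
  have "payoffs A \<mu> t b = (\<Sum>i<m. A $$ (i, b) * \<mu> t $ i)"
    using A b mu(1) by (simp add: scalar_prod_def lessThan_atLeast0)
  also have "\<bar>\<dots>\<bar> \<le> (\<Sum>i<m. \<bar>A $$ (i, b) * \<mu> t $ i\<bar>)" by (rule sum_abs)
  also have "\<dots> \<le> (\<Sum>i<m. max_norm A * \<mu> t $ i)"
  proof (rule sum_mono)
    fix i assume "i \<in> {..<m}"
    then show "\<bar>A $$ (i, b) * \<mu> t $ i\<bar> \<le> max_norm A * \<mu> t $ i"
      using mu(2) abs_entry_le_max_norm[of i A b] A b by (auto simp: abs_mult intro!: mult_right_mono)
  qed
  also have "\<dots> = max_norm A" by (simp add: sum_distrib_left[symmetric] mu(3))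
  finally show ?thesis .
qed

lemma uniform_policy_in_simplex: "n \<ge> 1 \<Longrightarrow> uniform_policy n \<in> simplex n"
  by (auto simp: uniform_policy_def simplex_def)

text \<open>The regret is linear in the comparator, so it suffices to bound it against pure actions.\<close>

lemma regret_le_if_pure:
  assumes A: "A \<in> carrier_mat m n" and n: "n \<ge> 1" and \<mu>: "\<And>t. \<mu> t \<in> simplex m"
    and pure: "\<And>b. b < n \<Longrightarrow> (\<Sum>t=0..T. loss A (\<mu> t) (\<nu> t)) \<le> (\<Sum>t=0..T. payoffs A \<mu> t b) + R"
  shows "regret A \<mu> \<nu> T \<le> R"
proof -
  define L where "L = (\<Sum>t=0..T. loss A (\<mu> t) (\<nu> t))"
  have "L - R \<le> (INF \<nu>'\<in>simplex n. \<Sum>t=0..T. loss A (\<mu> t) \<nu>')"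
  proof (rule cINF_greatest)
    show "simplex n \<noteq> {}" using uniform_policy_in_simplex[OF n] by auto
    fix v assume "v \<in> simplex n"
    then have v: "v \<in> carrier_vec n" "\<And>b. b < n \<Longrightarrow> 0 \<le> v $ b" "(\<Sum>b<n. v $ b) = 1"
      by (auto simp: simplex_def)
    \<comment> \<open>As \<open>v\<close> has mass 1, the constant is its own average and can be
      compared action by action.\<close>
    have "L - R = (\<Sum>b<n. v $ b * (L - R))" using v(3) by (simp add: sum_distrib_right[symmetric])
    also have "\<dots> \<le> (\<Sum>b<n. v $ b * (\<Sum>t=0..T. payoffs A \<mu> t b))"
      using pure v(2) by (intro sum_mono mult_left_mono) (auto simp: L_def algebra_simps)
    also have "\<dots> = (\<Sum>t=0..T. \<Sum>b<n. payoffs A \<mu> t b * v $ b)"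
      unfolding sum_distrib_left by (subst sum.swap) (simp add: mult.commute)
    also have "\<dots> = (\<Sum>t=0..T. loss A (\<mu> t) v)"
      using \<mu> v(1) by (intro sum.cong refl loss_eq_sum[OF A, symmetric]) (auto simp: simplex_def)
    finally show "L - R \<le> (\<Sum>t=0..T. loss A (\<mu> t) v)" .
  qed
  then show ?thesis using A by (simp add: regret_def L_def)
qed

text \<open>The common source of the explicit bound and of the asymptotic one.\<close>

lemma omwu_regret_le:
  assumes A: "A \<in> carrier_mat m n" and n: "n \<ge> 1" and \<tau>: "\<tau> > 0"
    and \<mu>: "\<And>t. \<mu> t \<in> simplex m" and T: "T \<ge> 1"
  shows "omwu_regret A \<tau> \<mu> T
    \<le> 8 * (max_norm A)\<^sup>2 / \<tau> * (ln (real T) + 1) + 2 * max_norm A + \<tau> * real T * ln (real n)"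
  unfolding omwu_regret_def
proof (rule regret_le_if_pure[OF A n \<mu>])
  fix b assume b: "b < n"
  define \<nu> where "\<nu> = omwu_pred A \<tau> (step_size \<tau>) \<mu>"
  \<comment> \<open>The barred policies as functions on actions; the case split separates the
    uniform start from the softmax form, where \<open>t - 1\<close> is a true predecessor.\<close>
  define \<pi> where "\<pi> t = (if t = 0 then \<lambda>_. 1 / real n else softmax {..<n}
    (\<lambda>j. - (cum_loss (payoffs A \<mu>) (t - 1) j + payoffs A \<mu> (t - 1) j) / (real t * \<tau>)))" for t
  have dim: "dim_col A = n" using A by auto
  have \<nu>: "\<nu> t = vec n (\<pi> t)" for t
  proof (cases t)
    case 0
    then show ?thesis by (simp add: \<nu>_def \<pi>_def uniform_policy_def dim)
  next
    case (Suc s)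
    then show ?thesis
      using omwu_pred_Suc_eq_softmax[OF dim n \<tau>] by (simp add: \<nu>_def \<pi>_def del: omwu_pred.simps)
  qed
  have "(\<Sum>t=0..T. loss A (\<mu> t) (\<nu> t)) = (\<Sum>t=0..T. \<Sum>j<n. payoffs A \<mu> t j * \<pi> t j)"
  proof (rule sum.cong[OF refl])
    fix t
    have "loss A (\<mu> t) (\<nu> t) = (\<Sum>j<n. payoffs A \<mu> t j * \<nu> t $ j)"
      using \<mu>[of t] by (intro loss_eq_sum[OF A]) (auto simp: simplex_def \<nu>)
    then show "loss A (\<mu> t) (\<nu> t) = (\<Sum>j<n. payoffs A \<mu> t j * \<pi> t j)" by (simp add: \<nu>)
  qed
  also have "\<dots> \<le> (\<Sum>t=0..T. payoffs A \<mu> t b) + 8 * (max_norm A)\<^sup>2 / \<tau> * (ln (real T) + 1)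
      + 2 * max_norm A + \<tau> * real T * ln (card {..<n})"
  proof (rule optimistic_regret_le)
    show "(\<Sum>j<n. \<bar>\<pi> 0 j\<bar>) = 1" using n by (simp add: \<pi>_def)
    show "\<pi> (Suc t) = softmax {..<n}
        (\<lambda>j. - (cum_loss (payoffs A \<mu>) t j + payoffs A \<mu> t j) / (real (Suc t) * \<tau>))" for t
      by (simp add: \<pi>_def)
    show "\<bar>payoffs A \<mu> t j\<bar> \<le> max_norm A" if "j \<in> {..<n}" for t j
      using abs_payoffs_le_max_norm[OF A \<mu>] that by auto
  qed (use b \<tau> T in auto)
  finally show "(\<Sum>t=0..T. loss A (\<mu> t) (omwu_pred A \<tau> (step_size \<tau>) \<mu> t))
      \<le> (\<Sum>t=0..T. payoffs A \<mu> t b) + (8 * (max_norm A)\<^sup>2 / \<tau> * (ln (real T) + 1)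
      + 2 * max_norm A + \<tau> * real T * ln (real n))"
    by (simp add: \<nu>_def)
qed

section \<open>From the common bound to the two stated forms\<close>

lemma regret_bound_explicit:
  fixes M L \<tau> :: real
  assumes "M \<ge> 0" "L \<ge> 0" "\<tau> > 0" "T \<ge> 1"
  shows "8 * M\<^sup>2 / \<tau> * (ln (real T) + 1) + 2 * M + \<tau> * real T * L
    \<le> inverse \<tau> * (ln (real T) + 1) * (\<tau> * L + 5 * M)\<^sup>2 + 4 * M + 2 * \<tau> * real T * L"
proof -
  \<comment> \<open>Only 8 \<le> 25 is used, so the square on the right absorbs the harmonic term
    with room to spare.\<close>
  have "(5 * M)\<^sup>2 \<le> (\<tau> * L + 5 * M)\<^sup>2" using assms by (intro power_mono) auto
  moreover have "8 * M\<^sup>2 \<le> (5 * M)\<^sup>2" by (simp add: power_mult_distrib)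
  ultimately have "8 * M\<^sup>2 \<le> (\<tau> * L + 5 * M)\<^sup>2" by linarith
  then have "inverse \<tau> * (ln (real T) + 1) * (8 * M\<^sup>2)
      \<le> inverse \<tau> * (ln (real T) + 1) * (\<tau> * L + 5 * M)\<^sup>2"
    using assms by (intro mult_left_mono mult_nonneg_nonneg) auto
  moreover have "0 \<le> \<tau> * real T * L" using assms by simp
  moreover have "8 * M\<^sup>2 / \<tau> * (ln (real T) + 1) = inverse \<tau> * (ln (real T) + 1) * (8 * M\<^sup>2)"
    by (simp add: divide_inverse)
  ultimately show ?thesis using assms(1) by linarith
qed

text \<open>With r = sqrt (ln T / T) and s = sqrt (T ln T), one has T r = s and r s = ln T. The
  lower bound on \<tau> turns ln T / \<tau> into at most s / \<open>c\<^sub>1\<close>, and the upper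
  bound turns \<tau> T into at most \<open>c\<^sub>2\<close> s.\<close>

lemma regret_bound_sqrt:
  fixes M L \<tau> :: real
  assumes M: "M \<ge> 0" and L: "L \<ge> 0" and c: "c\<^sub>1 > 0" and T: "T \<ge> 2"
    and lo: "c\<^sub>1 * sqrt (ln (real T) / real T) \<le> \<tau>"
    and hi: "\<tau> \<le> c\<^sub>2 * sqrt (ln (real T) / real T)"
  shows "8 * M\<^sup>2 / \<tau> * (ln (real T) + 1) + 2 * M + \<tau> * real T * L
    \<le> (24 * M\<^sup>2 / c\<^sub>1 + 4 * M + c\<^sub>2 * L) * sqrt (real T * ln (real T))"
proof -
  define r where "r = sqrt (ln (real T) / real T)"
  define s where "s = sqrt (real T * ln (real T))"
  \<comment> \<open>This threshold gives ln T + 1 \<le> 3 ln T, whence 24 = 8 * 3, and also s \<ge>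
    1, which absorbs the constant term.\<close>
  have ln2: "1 / 2 \<le> ln (real T)"
  proof -
    have "1 / 2 \<le> ln (2 :: real)" using ln_le_minus_one[of "1 / 2 :: real"] by (simp add: ln_div)
    also have "\<dots> \<le> ln (real T)" using T by simp
    finally show ?thesis .
  qed
  have r: "r > 0" using ln2 T by (simp add: r_def)
  have Tr: "real T * r = s" using T by (simp add: r_def s_def real_sqrt_divide real_sqrt_mult field_simps)
  have rs: "r * s = ln (real T)"
    using ln2 T by (simp add: r_def s_def real_sqrt_mult[symmetric])
  have s1: "1 \<le> s"
  proof -
    have "1 = 2 * (1 / 2 :: real)" by simp
    also have "\<dots> \<le> real T * ln (real T)" using ln2 T by (intro mult_mono) auto
    finally show ?thesis by (simp add: s_def)
  qed
  have tau: "\<tau> > 0" using lo c r unfolding r_def[symmetric] by (meson less_le_trans mult_pos_pos)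
  have "(ln (real T) + 1) / \<tau> \<le> 3 * ln (real T) / (c\<^sub>1 * r)"
    using lo ln2 c r tau unfolding r_def[symmetric] by (intro frac_le) auto
  also have "\<dots> = 3 / c\<^sub>1 * s" using rs r c by (simp add: field_simps)
  finally have "8 * M\<^sup>2 * ((ln (real T) + 1) / \<tau>) \<le> 8 * M\<^sup>2 * (3 / c\<^sub>1 * s)"
    by (intro mult_left_mono) auto
  moreover have "2 * M \<le> 4 * M * s" using M s1 mult_left_mono[of 1 s "4 * M"] by linarith
  moreover have "\<tau> * (real T * L) \<le> (c\<^sub>2 * r) * (real T * L)"
    using hi L unfolding r_def[symmetric] by (intro mult_right_mono) auto
  moreover have "(c\<^sub>2 * r) * (real T * L) = c\<^sub>2 * L * s" by (simp add: Tr[symmetric])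
  ultimately show ?thesis
    unfolding s_def[symmetric] by (simp add: distrib_right)
qed

theorem mainTheorem4:
  shows "(\<forall>(m::nat) (n::nat) (A::real mat) (\<tau>::real) (\<mu>::nat \<Rightarrow> real vec) (T::nat).
            m \<ge> 1 \<longrightarrow> n \<ge> 1 \<longrightarrow> A \<in> carrier_mat m n \<longrightarrow> \<tau> > 0 \<longrightarrow>
            (\<forall>t. \<mu> t \<in> simplex m) \<longrightarrow> T \<ge> 1 \<longrightarrow>
            omwu_regret A \<tau> \<mu> T
              \<le> inverse \<tau> * (ln (real T) + 1) * (\<tau> * ln (real n) + 5 * max_norm A)\<^sup>2
                 + 4 * max_norm A + 2 * \<tau> * real T * ln (real n))
       \<and> (\<forall>(n::nat) (M::real) (c\<^sub>1::real) (c\<^sub>2::real). n \<ge> 1 \<longrightarrow> c\<^sub>1 > 0 \<longrightarrow> c\<^sub>2 > 0 \<longrightarrow>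
            (\<exists>C::real. \<forall>(m::nat) (A::real mat) (\<tau>::real) (\<mu>::nat \<Rightarrow> real vec) (T::nat).
               m \<ge> 1 \<longrightarrow> A \<in> carrier_mat m n \<longrightarrow> max_norm A = M \<longrightarrow>
               (\<forall>t. \<mu> t \<in> simplex m) \<longrightarrow> T \<ge> 2 \<longrightarrow>
               c\<^sub>1 * sqrt (ln (real T) / real T) \<le> \<tau> \<longrightarrow>
               \<tau> \<le> c\<^sub>2 * sqrt (ln (real T) / real T) \<longrightarrow>
               omwu_regret A \<tau> \<mu> T \<le> C * sqrt (real T * ln (real T))))"
proof (intro conjI allI impI)
  fix m n :: nat and A :: "real mat" and \<tau> :: real and \<mu> :: "nat \<Rightarrow> real vec" and T :: nat
  assume h: "m \<ge> 1" "n \<ge> 1" "A \<in> carrier_mat m n" "\<tau> > 0" "\<forall>t. \<mu> t \<in> simplex m" "T \<ge> 1"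
  \<comment> \<open>The entry at (0, 0) exists since both dimensions are at least 1.\<close>
  have "0 \<le> max_norm A" using abs_entry_le_max_norm[of 0 A 0] h by auto
  then show "omwu_regret A \<tau> \<mu> T
      \<le> inverse \<tau> * (ln (real T) + 1) * (\<tau> * ln (real n) + 5 * max_norm A)\<^sup>2
        + 4 * max_norm A + 2 * \<tau> * real T * ln (real n)"
    using h by (intro order.trans[OF omwu_regret_le regret_bound_explicit]) auto
next
  fix n :: nat and M c\<^sub>1 c\<^sub>2 :: real
  assume n: "n \<ge> 1" and c: "c\<^sub>1 > 0" "c\<^sub>2 > 0"
  show "\<exists>C::real. \<forall>(m::nat) (A::real mat) (\<tau>::real) (\<mu>::nat \<Rightarrow> real vec) (T::nat).
               m \<ge> 1 \<longrightarrow> A \<in> carrier_mat m n \<longrightarrow> max_norm A = M \<longrightarrow>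
               (\<forall>t. \<mu> t \<in> simplex m) \<longrightarrow> T \<ge> 2 \<longrightarrow>
               c\<^sub>1 * sqrt (ln (real T) / real T) \<le> \<tau> \<longrightarrow>
               \<tau> \<le> c\<^sub>2 * sqrt (ln (real T) / real T) \<longrightarrow>
               omwu_regret A \<tau> \<mu> T \<le> C * sqrt (real T * ln (real T))"
  \<comment> \<open>The witness appears in the final bound of this block. It mentions only
    \<open>n\<close>, \<open>M\<close>, \<open>c\<^sub>1\<close> and \<open>c\<^sub>2\<close>, so it
    is uniform in the remaining variables.\<close>
  proof (intro exI allI impI)
    fix m :: nat and A :: "real mat" and \<tau> :: real and \<mu> :: "nat \<Rightarrow> real vec" and T :: nat
    assume h: "m \<ge> 1" "A \<in> carrier_mat m n" "max_norm A = M" "\<forall>t. \<mu> t \<in> simplex m" "T \<ge> 2"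
      and lo: "c\<^sub>1 * sqrt (ln (real T) / real T) \<le> \<tau>"
      and hi: "\<tau> \<le> c\<^sub>2 * sqrt (ln (real T) / real T)"
    have M: "0 \<le> M" using abs_entry_le_max_norm[of 0 A 0] h n by auto
    \<comment> \<open>For T \<ge> 2 the logarithm is positive, so the lower bound forces \<tau> >
      0.\<close>
    have "0 < c\<^sub>1 * sqrt (ln (real T) / real T)" using c h(5) by simp
    then have "\<tau> > 0" using lo by linarith
    then have "omwu_regret A \<tau> \<mu> T
        \<le> 8 * M\<^sup>2 / \<tau> * (ln (real T) + 1) + 2 * M + \<tau> * real T * ln (real n)"
      using omwu_regret_le[OF h(2) n, of \<tau> \<mu> T] h by simp
    also have "\<dots> \<le> (24 * M\<^sup>2 / c\<^sub>1 + 4 * M + c\<^sub>2 * ln (real n)) * sqrt (real T * ln (real T))"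
      using n by (intro regret_bound_sqrt[OF M _ c(1) h(5) lo hi]) simp
    finally show "omwu_regret A \<tau> \<mu> T
        \<le> (24 * M\<^sup>2 / c\<^sub>1 + 4 * M + c\<^sub>2 * ln (real n)) * sqrt (real T * ln (real T))" .
  qed
qed

end
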